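(* Let $D$ be a random variable taking values in the non-negative integers such that $\mathbb{P}(D\le 1)=p>0$. Let $\lambda\ge 1$ be a fixed integer and consider the compartment model $G_n$ on the circle (the case $d=1$) with $k(n)$ compartments containing $m(n)=\lambda$ vertices each for all $n$, where $\lim_{n\to\infty}\frac{k(n)\lambda}{n}=1$, and with degree sequence $d_n$ whose entries are sampled independently from the distribution of $D$. Let $L_1(G_n)$ denote the number of vertices of the largest connected component of $G_n$. Then $$\lim_{n\to\infty}\frac{L_1(G_n)}{n}=0$$ in probability.
   Context: Compartment model on the circle. For each $n$ let $k(n),m(n)$ be positive integers. The vertex set $V_n$ is the disjoint union of compartments $C_i^n$, $i\in\{1,\dots,k(n)\}$, each containing $m(n)$ vertices; indices are taken modulo $k(n)$, and $|i-j|$ is the corresponding cyclic distance. A degree sequence $d_n$ assigns to each vertex $x\in V_n$ a non-negative integer $d_n(x)$. Given $d_n$, the random multigraph $G_n$ is built as follows: each vertex $x$ is given $d_n(x)$ half-edges; two half-edges attached to vertices $x\in C_i^n$ and $y\in C_j^n$ are allowed to be connected if and only if $|i-j|\le 1$; at each iteration a pair of unmatched half-edges is chosen uniformly among all allowed pairs and is joined into an edge; this is repeated until no allowed pair remains (leftover half-edges are discarded). Self-loops and multiple edges are permitted. *)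

theory Defs
  imports "HOL-Probability.Probability"
begin

text \<open>A vertex is a pair (compartment index, label inside the compartment); compartment indices
  are residues modulo \<open>k\<close>, represented by \<open>0, \<dots>, k - 1\<close>. A half-edge is a vertex together with
  a running number.\<close>

type_synonym vertex = "nat \<times> nat"
type_synonym half_edge = "vertex \<times> nat"

definition cyc_dist :: "nat \<Rightarrow> nat \<Rightarrow> nat \<Rightarrow> nat" where
  "cyc_dist k i j = nat (min ((int i - int j) mod int k) ((int j - int i) mod int k))"

definition compartment :: "nat \<Rightarrow> nat \<Rightarrow> vertex set" where
  "compartment m i = {i} \<times> {..<m}"

definition vertices :: "nat \<Rightarrow> nat \<Rightarrow> vertex set" where
  "vertices k m = (\<Union>i<k. compartment m i)"

definition half_edges :: "nat \<Rightarrow> nat \<Rightarrow> (vertex \<Rightarrow> nat) \<Rightarrow> half_edge set" where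
  "half_edges k m d = (SIGMA x : vertices k m. {..<d x})"

text \<open>The condition \<open>h \<noteq> h'\<close> only excludes joining a half-edge to itself; two different half-edges
  of the same vertex form an allowed pair (and joining them creates a self-loop).\<close>

definition allowed_pairs :: "nat \<Rightarrow> half_edge set \<Rightarrow> half_edge set set" where
  "allowed_pairs k H =
     {{h, h'} | h h'. h \<in> H \<and> h' \<in> H \<and> h \<noteq> h' \<and> cyc_dist k (fst (fst h)) (fst (fst h')) \<le> 1}"

lemma finite_allowed_pairs: "finite H \<Longrightarrow> finite (allowed_pairs k H)"
  by (rule finite_subset[of _ "Pow H"]) (auto simp: allowed_pairs_def)

lemma allowed_pairs_decreasing:
  assumes "finite H" "e \<in> allowed_pairs k H"
  shows "card (H - e) < card H"
  using assms by (intro psubset_card_mono) (auto simp: allowed_pairs_def)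

text \<open>\<open>random_matching k H\<close> is the law of the set of edges produced by the matching process started
  with the set \<open>H\<close> of unmatched half-edges. An edge is recorded as the pair of half-edges it joins,
  so multiple edges remain distinct. The process is only meant for finite \<open>H\<close>; the finiteness
  test makes the function total.\<close>

function random_matching :: "nat \<Rightarrow> half_edge set \<Rightarrow> half_edge set set pmf" where
  "random_matching k H =
     (if finite H \<and> allowed_pairs k H \<noteq> {}
      then bind_pmf (pmf_of_set (allowed_pairs k H))
             (\<lambda>e. map_pmf (insert e) (random_matching k (H - e)))
      else return_pmf {})"
  by pat_completeness auto
termination
  by (relation "Wellfounded.measure (\<lambda>(k, H). card H)")
     (auto simp: finite_allowed_pairs allowed_pairs_decreasing)

declare random_matching.simps [simp del]

text \<open>The law of the edge set of the random multigraph with a given degree sequence \<open>d\<close>, and the law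
  when the degrees of the vertices are independent with law \<open>D\<close> (the default value \<open>0\<close> of
  \<open>Pi_pmf\<close> is only taken outside the vertex set, where it plays no role).\<close>

definition compartment_model :: "nat \<Rightarrow> nat \<Rightarrow> (vertex \<Rightarrow> nat) \<Rightarrow> half_edge set set pmf" where
  "compartment_model k m d = random_matching k (half_edges k m d)"

definition iid_compartment_model :: "nat \<Rightarrow> nat \<Rightarrow> nat pmf \<Rightarrow> half_edge set set pmf" where
  "iid_compartment_model k m D =
     bind_pmf (Pi_pmf (vertices k m) 0 (\<lambda>_. D)) (compartment_model k m)"

definition adjacency :: "half_edge set set \<Rightarrow> (vertex \<times> vertex) set" where
  "adjacency E = {(fst h, fst h') | h h'. {h, h'} \<in> E}"

definition component :: "vertex set \<Rightarrow> half_edge set set \<Rightarrow> vertex \<Rightarrow> vertex set" where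
  "component V E x = {y \<in> V. (x, y) \<in> (adjacency E)\<^sup>*}"

definition largest_component :: "vertex set \<Rightarrow> half_edge set set \<Rightarrow> nat" where
  "largest_component V E = Max ((\<lambda>x. card (component V E x)) ` V)"

end

theory Submission
  imports Defs "HOL-Real_Asymp.Real_Asymp"
begin

text \<open>A compartment all of whose vertices have degree at most one is a barrier: every vertex of it
  is a leaf, so no path passes through it, and edges cannot jump over it. Hence every component is
  confined between the barriers that surround it, whatever the matching is. A window of \<open>L\<close>
  consecutive compartments contains no barrier with probability \<open>(1 - p ^ l) ^ L\<close>, and a union
  bound over the \<open>k n\<close> windows shows that with high probability no gap between barriers has
  length proportional to \<open>n\<close>.\<close>

definition barrier :: "nat \<Rightarrow> (vertex \<Rightarrow> nat) \<Rightarrow> nat \<Rightarrow> bool" where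
  "barrier m d j \<longleftrightarrow> (\<forall>v<m. d (j, v) \<le> 1)"

section \<open>Outcomes of the matching process\<close>

lemma allowed_pairs_mono: "H \<subseteq> H' \<Longrightarrow> allowed_pairs k H \<subseteq> allowed_pairs k H'"
  unfolding allowed_pairs_def by blast

lemma allowed_pairs_subset: "e \<in> allowed_pairs k H \<Longrightarrow> e \<subseteq> H"
  unfolding allowed_pairs_def by blast

text \<open>Each round removes both ends of the chosen pair from the pool, so all later pairs avoid
  it and remain allowed for the larger pool. These two properties are what the barrier argument uses
  about an outcome.\<close>

lemma set_random_matching:
  assumes "E \<in> set_pmf (random_matching k H)"
  shows "E \<subseteq> allowed_pairs k H \<and> disjoint E"
  using assms
proof (induction k H arbitrary: E rule: random_matching.induct)
  case (1 k H)
  show ?case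
  proof (cases "finite H \<and> allowed_pairs k H \<noteq> {}")
    case True
    then have fin: "finite (allowed_pairs k H)" and ne: "allowed_pairs k H \<noteq> {}"
      by (auto intro: finite_allowed_pairs)
    from "1.prems" True fin obtain e F where e: "e \<in> allowed_pairs k H"
      and F: "F \<in> set_pmf (random_matching k (H - e))" and E: "E = insert e F"
      by (subst (asm) random_matching.simps) auto
    have IH: "F \<subseteq> allowed_pairs k (H - e)" "disjoint F"
      using "1.IH"[OF True _ F] e fin ne by auto
    have "F \<subseteq> allowed_pairs k H"
      using IH(1) allowed_pairs_mono[of "H - e" H k] by auto
    moreover have "e \<inter> f = {}" if "f \<in> F" for f
      using that IH(1) allowed_pairs_subset[of f k "H - e"] by auto
    ultimately show ?thesis
      using e IH(2) unfolding E pairwise_insert disjnt_def by auto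
  next
    case False
    with "1.prems" show ?thesis
      by (subst (asm) random_matching.simps) auto
  qed
qed

text \<open>A signed shift \<open>e\<close> replaces the cyclic distance so that a path on the
  circle can be lifted to integer offsets, where "between two barriers" is an ordinary
  interval.\<close>

lemma cyc_dist_le_1D:
  assumes "cyc_dist k i j \<le> 1" "j < k"
  obtains e :: int where "\<bar>e\<bar> \<le> 1" "int j = (int i + e) mod int k"
proof -
  from assms(2) have k: "int k > 0" and j: "int j mod int k = int j" by auto
  from assms(1) k have "(int i - int j) mod int k \<in> {0, 1} \<or> (int j - int i) mod int k \<in> {0, 1}"
    using pos_mod_sign[OF k, of "int i - int j"] pos_mod_sign[OF k, of "int j - int i"]
    unfolding cyc_dist_def min_def insert_iff empty_iff by (simp split: if_splits; linarith)
  then show ?thesis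
  proof
    assume "(int i - int j) mod int k \<in> {0, 1}"
    moreover have "(int i + (- ((int i - int j) mod int k))) mod int k = int j"
      using j by (simp add: mod_diff_right_eq)
    ultimately show ?thesis
      by (intro that[of "- ((int i - int j) mod int k)"]) auto
  next
    assume "(int j - int i) mod int k \<in> {0, 1}"
    moreover have "(int i + ((int j - int i) mod int k)) mod int k = int j"
      using j by (simp add: mod_add_right_eq)
    ultimately show ?thesis
      by (intro that[of "(int j - int i) mod int k"]) auto
  qed
qed

section \<open>Adjacency, leaves and confinement between barriers\<close>

lemma adjacency_step:
  assumes "E \<subseteq> allowed_pairs k (half_edges k m d)" "(x, y) \<in> adjacency E"
  obtains e :: int where "\<bar>e\<bar> \<le> 1" "int (fst y) = (int (fst x) + e) mod int k"
proof -
  from assms(2) obtain h h' where E: "{h, h'} \<in> E" and xy: "x = fst h" "y = fst h'"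
    unfolding adjacency_def by blast
  from E assms(1) have "{h, h'} \<in> allowed_pairs k (half_edges k m d)" by blast
  then obtain g g' where g: "{h, h'} = {g, g'}" "g \<in> half_edges k m d" "g' \<in> half_edges k m d"
    "cyc_dist k (fst (fst g)) (fst (fst g')) \<le> 1"
    unfolding allowed_pairs_def by blast
  have "h' \<in> half_edges k m d" using g by (auto simp: doubleton_eq_iff)
  then have "fst y < k"
    unfolding xy half_edges_def vertices_def compartment_def by auto
  \<comment> \<open>Edges are unordered, so \<open>g\<close> and \<open>g'\<close> may be the two
    ends in either order; the symmetry of \<open>cyc_dist\<close> covers both cases.\<close>
  moreover have "cyc_dist k (fst x) (fst y) \<le> 1"
    using g(1,4) unfolding xy by (auto simp: doubleton_eq_iff cyc_dist_def min.commute)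
  ultimately show ?thesis
    using that by (metis cyc_dist_le_1D)
qed

lemma adjacency_vertices:
  assumes "E \<subseteq> allowed_pairs k (half_edges k m d)" "(x, y) \<in> adjacency E"
  shows "y \<in> vertices k m"
proof -
  from assms(2) obtain h h' where "{h, h'} \<in> E" "y = fst h'"
    unfolding adjacency_def by blast
  then have "h' \<in> half_edges k m d"
    using assms(1) allowed_pairs_subset[of "{h, h'}" k "half_edges k m d"] by blast
  then show ?thesis using \<open>y = fst h'\<close> unfolding half_edges_def by auto
qed

text \<open>A vertex of degree at most one has a single half-edge, so both edges at \<open>y\<close>
  contain it; disjointness of the matching makes them the same edge, with the same other
  end.\<close>

lemma adjacency_leaf_unique:
  assumes E: "E \<subseteq> allowed_pairs k (half_edges k m d)" "disjoint E"
    and "d y \<le> 1" "(z, y) \<in> adjacency E" "(y, w) \<in> adjacency E"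
  shows "w = z"
proof -
  from assms(4) obtain h h' where h: "{h, h'} \<in> E" "z = fst h" "y = fst h'"
    unfolding adjacency_def by blast
  from assms(5) obtain g g' where g: "{g, g'} \<in> E" "y = fst g" "w = fst g'"
    unfolding adjacency_def by blast
  have "{h, h'} \<subseteq> half_edges k m d" "{g, g'} \<subseteq> half_edges k m d"
    using h(1) g(1) E(1) by (meson allowed_pairs_subset subsetD)+
  then have "snd h' < d y" "snd g < d y"
    using h(3) g(2) unfolding half_edges_def by auto
  with assms(3) have "snd h' = snd g" by linarith
  with h(3) g(2) have "h' = g" by (simp add: prod_eq_iff)
  then have "\<not> disjnt {h, h'} {g, g'}" by (simp add: disjnt_def)
  with pairwiseD[OF E(2) h(1) g(1)] have "{h, h'} = {g, g'}" by blast
  with \<open>h' = g\<close> have "h = g'" unfolding doubleton_eq_iff by blast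
  with h(2) g(3) show ?thesis by simp
qed

text \<open>Offsets are integers with no upper bound on \<open>b - a\<close>: the interval may wrap
  around the circle and both barriers may be the same compartment, without any case
  distinction.\<close>

lemma component_between_barriers:
  fixes a b :: int
  assumes E: "E \<subseteq> allowed_pairs k (half_edges k m d)" "disjoint E"
    and "k > 0" and x: "x \<in> vertices k m" and "a < 0" "b > 0"
    and a: "barrier m d (nat ((int (fst x) + a) mod int k))"
    and b: "barrier m d (nat ((int (fst x) + b) mod int k))"
  shows "component (vertices k m) E x
           \<subseteq> (\<Union>c\<in>{a..b}. compartment m (nat ((int (fst x) + c) mod int k)))"
proof
  define pos where "pos c = (int (fst x) + c) mod int k" for c
  define A where "A = {y :: vertex. \<exists>c. a < c \<and> c < b \<and> int (fst y) = pos c}"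
  \<comment> \<open>\<open>A\<close> together with the leaves hanging off \<open>A\<close> in the two barriers is closed under adjacency.\<close>
  define S where "S = A \<union> {y. int (fst y) \<in> {pos a, pos b} \<and> (\<exists>z\<in>A. (z, y) \<in> adjacency E)}"
  have step_pos: "\<exists>c'. \<bar>c' - c\<bar> \<le> 1 \<and> int (fst w) = pos c'"
    if "(y, w) \<in> adjacency E" "int (fst y) = pos c" for y w c
  proof -
    from adjacency_step[OF E(1) that(1)] obtain e :: int
      where "\<bar>e\<bar> \<le> 1" "int (fst w) = (int (fst y) + e) mod int k" by blast
    then have "int (fst w) = pos (c + e)"
      using that(2) by (simp add: pos_def mod_add_left_eq add.assoc)
    with \<open>\<bar>e\<bar> \<le> 1\<close> show ?thesis by (intro exI[of _ "c + e"]) auto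
  qed
  have closed: "w \<in> S" if "y \<in> S" "(y, w) \<in> adjacency E" for y w
  proof (cases "y \<in> A")
    case True
    then obtain c where c: "a < c" "c < b" "int (fst y) = pos c" unfolding A_def by blast
    from step_pos[OF that(2) c(3)] obtain c' where c': "\<bar>c' - c\<bar> \<le> 1" "int (fst w) = pos c'"
      by blast
    \<comment> \<open>The lifted offset moves by at most one, so it can leave the open interval only
      by landing exactly on a barrier.\<close>
    consider "a < c'" "c' < b" | "c' = a" | "c' = b" using c c' by linarith
    then show ?thesis
    proof cases
      case 1
      with c' have "w \<in> A" unfolding A_def by blast
      then show ?thesis by (simp add: S_def)
    qed (use True that(2) c' in \<open>auto simp: S_def\<close>)
  next
    case False
    \<comment> \<open>Here \<open>y\<close> is a leaf in a barrier and was reached from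
      \<open>z\<close> in \<open>A\<close>; its only neighbour is \<open>z\<close>, so the path has
      to turn back into \<open>A\<close>.\<close>
    with that(1) obtain z where z: "z \<in> A" "(z, y) \<in> adjacency E"
      and y: "int (fst y) \<in> {pos a, pos b}" unfolding S_def by blast
    have "snd y < m"
      using adjacency_vertices[OF E(1) z(2)] unfolding vertices_def compartment_def by auto
    moreover from y have "fst y = nat (pos a) \<or> fst y = nat (pos b)" by auto
    then have "barrier m d (fst y)" using a b unfolding pos_def by auto
    ultimately have "d y \<le> 1" unfolding barrier_def by (metis prod.collapse)
    from adjacency_leaf_unique[OF E this z(2) that(2)] z(1) show ?thesis by (simp add: S_def)
  qed
  have "fst x < k" using x unfolding vertices_def compartment_def by auto
  then have "int (fst x) = pos 0" by (simp add: pos_def)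
  with \<open>a < 0\<close> \<open>b > 0\<close> have "x \<in> S" unfolding S_def A_def by blast
  fix y assume "y \<in> component (vertices k m) E x"
  then have "y \<in> vertices k m" "(x, y) \<in> (adjacency E)\<^sup>*" unfolding component_def by auto
  from this(2) have "y \<in> S"
    by (induction rule: rtrancl_induct) (use \<open>x \<in> S\<close> closed in auto)
  then have "\<exists>c\<in>{a..b}. int (fst y) = pos c"
  proof (cases "y \<in> A")
    case True
    then show ?thesis unfolding A_def by (auto intro: less_imp_le)
  next
    case False
    with \<open>y \<in> S\<close> have "int (fst y) = pos a \<or> int (fst y) = pos b" unfolding S_def by auto
    with \<open>a < 0\<close> \<open>b > 0\<close> show ?thesis by (auto intro: bexI[of _ a] bexI[of _ b])
  qed
  then obtain c where c: "c \<in> {a..b}" "int (fst y) = pos c" by blast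
  from c(2) have "fst y = nat (pos c)" by linarith
  with \<open>y \<in> vertices k m\<close> have "y \<in> compartment m (nat (pos c))"
    unfolding vertices_def compartment_def by auto
  with c(1) show "y \<in> (\<Union>c\<in>{a..b}. compartment m (nat ((int (fst x) + c) mod int k)))"
    unfolding pos_def by blast
qed

text \<open>There is a barrier within distance \<open>L\<close> on each side of \<open>x\<close>,
  which leaves at most \<open>2 * L + 1\<close> offsets. If these wrap around, compartments are
  counted repeatedly, which only enlarges the bound.\<close>

lemma card_component_le:
  assumes E: "E \<subseteq> allowed_pairs k (half_edges k m d)" "disjoint E"
    and "k > 0" and x: "x \<in> vertices k m"
    and window: "\<And>i. i < k \<Longrightarrow> \<exists>a\<in>{1..L}. barrier m d ((i + a) mod k)"
  shows "card (component (vertices k m) E x) \<le> (2 * L + 1) * m"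
proof -
  \<comment> \<open>Integer starting points are allowed because the window to the left of
    \<open>x\<close> may begin below 0.\<close>
  have window': "\<exists>a\<in>{1..int L}. barrier m d (nat ((i + a) mod int k))" for i :: int
  proof -
    have "nat (i mod int k) < k" using \<open>k > 0\<close> by (simp add: nat_less_iff)
    from window[OF this] obtain a where a: "a \<in> {1..L}"
      "barrier m d ((nat (i mod int k) + a) mod k)" by blast
    have "int ((nat (i mod int k) + a) mod k) = (i + int a) mod int k"
      using \<open>k > 0\<close> by (simp add: zmod_int mod_add_left_eq)
    then have "(nat (i mod int k) + a) mod k = nat ((i + int a) mod int k)" by linarith
    with a show ?thesis by (intro bexI[of _ "int a"]) auto
  qed
  from window'[of "int (fst x)"] obtain b where b: "b \<in> {1..int L}"
    "barrier m d (nat ((int (fst x) + b) mod int k))" by blast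
  \<comment> \<open>A window begins one step after its starting point, so this one covers exactly
    the \<open>L\<close> offsets from \<open>- L\<close> to \<open>- 1\<close>.\<close>
  from window'[of "int (fst x) - int L - 1"] obtain a' where a': "a' \<in> {1..int L}"
    "barrier m d (nat ((int (fst x) - int L - 1 + a') mod int k))" by blast
  define a where "a = a' - int L - 1"
  have a: "a \<in> {- int L..-1}" "barrier m d (nat ((int (fst x) + a) mod int k))"
    using a' by (auto simp: a_def algebra_simps)
  let ?C = "\<lambda>c. compartment m (nat ((int (fst x) + c) mod int k))"
  have "component (vertices k m) E x \<subseteq> (\<Union>c\<in>{a..b}. ?C c)"
    using a b by (intro component_between_barriers[OF E \<open>k > 0\<close> x]) auto
  also have "\<dots> \<subseteq> (\<Union>c\<in>{- int L..int L}. ?C c)"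
    using a b by (intro UN_mono) auto
  finally have "card (component (vertices k m) E x) \<le> card (\<Union>c\<in>{- int L..int L}. ?C c)"
    by (intro card_mono) (auto simp: compartment_def)
  also have "\<dots> \<le> (\<Sum>c\<in>{- int L..int L}. card (?C c))"
    by (intro card_UN_le) auto
  also have "\<dots> = (2 * L + 1) * m"
    by (simp add: compartment_def card_cartesian_product_singleton nat_add_distrib nat_mult_distrib)
  finally show ?thesis .
qed

section \<open>Probability that a window contains no barrier\<close>

lemma prob_pair_pmf_Times:
  "measure_pmf.prob (pair_pmf M N) (A \<times> B) = measure_pmf.prob M A * measure_pmf.prob N B"
proof -
  have "emeasure (pair_pmf M N) (A \<times> B)
      = (\<integral>\<^sup>+z. indicator (A \<times> B) z \<partial>measure_pmf (pair_pmf M N))" by simp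
  also have "\<dots> = (\<integral>\<^sup>+x. \<integral>\<^sup>+y. indicator A x * indicator B y \<partial>measure_pmf N \<partial>measure_pmf M)"
    by (subst nn_integral_pair_pmf') (simp add: indicator_times)
  also have "\<dots> = emeasure M A * emeasure N B"
    by (simp add: nn_integral_cmult nn_integral_multc)
  finally show ?thesis
    by (simp add: measure_pmf.emeasure_eq_measure flip: ennreal_mult)
qed

text \<open>Distinct rows use disjoint sets of independent coordinates. The induction splits off one
  row at a time, and each contributes the complement of the event that all its entries lie in
  \<open>X\<close>.\<close>

lemma prob_Pi_pmf_all_rows:
  fixes D :: "'a pmf" and J :: "'b set" and V :: "'c set"
  assumes "finite J" "finite V"
  shows "measure_pmf.prob (Pi_pmf (J \<times> V) dflt (\<lambda>_. D)) {d. \<forall>j\<in>J. \<exists>v\<in>V. d (j, v) \<notin> X}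
           = (1 - measure_pmf.prob D X ^ card V) ^ card J"
  using assms(1)
proof (induction J rule: finite_induct)
  case (insert j J)
  let ?P = "\<lambda>J. Pi_pmf (J \<times> V) dflt (\<lambda>_. D)"
  let ?R = "{d :: 'b \<times> 'c \<Rightarrow> 'a. \<exists>v\<in>V. d (j, v) \<notin> X}"
  let ?S = "{d :: 'b \<times> 'c \<Rightarrow> 'a. \<forall>j\<in>J. \<exists>v\<in>V. d (j, v) \<notin> X}"
  have row: "measure_pmf.prob (?P {j}) ?R = 1 - measure_pmf.prob D X ^ card V"
  proof -
    have "measure_pmf.prob (?P {j}) (- ?R)
            = measure_pmf.prob (?P {j}) (Pi ({j} \<times> V) (\<lambda>_. X))"
      by (intro arg_cong[where f = "measure_pmf.prob _"]) auto
    also have "\<dots> = (\<Prod>_\<in>{j} \<times> V. measure_pmf.prob D X)"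
      using assms(2) by (intro measure_Pi_pmf_Pi) auto
    also have "\<dots> = measure_pmf.prob D X ^ card V"
      by (simp add: card_cartesian_product_singleton)
    finally show ?thesis
      using measure_pmf.prob_compl[of ?R "?P {j}"] by (simp add: Compl_eq_Diff_UNIV)
  qed
  have "?P (insert j J) = Pi_pmf ({j} \<times> V \<union> J \<times> V) dflt (\<lambda>_. D)"
    by (intro arg_cong[where f = "\<lambda>A. Pi_pmf A _ _"]) auto
  also have "\<dots> = map_pmf (\<lambda>(f, g) x. if x \<in> {j} \<times> V then f x else g x) (pair_pmf (?P {j}) (?P J))"
    using assms(2) insert.hyps by (intro Pi_pmf_union) auto
  \<comment> \<open>Since \<open>j\<close> is not in \<open>J\<close>, the merged function reads row
    \<open>j\<close> from the first factor and the rows in \<open>J\<close> from the second, so the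
    event pulls back to a rectangle.\<close>
  finally have "measure_pmf.prob (?P (insert j J)) {d. \<forall>j\<in>insert j J. \<exists>v\<in>V. d (j, v) \<notin> X}
      = measure_pmf.prob (pair_pmf (?P {j}) (?P J)) (?R \<times> ?S)"
    using insert.hyps(2) by (simp add: vimage_def split_beta)
      (intro arg_cong[where f = "measure_pmf.prob _"], auto, metis+)
  also have "\<dots> = measure_pmf.prob (?P {j}) ?R * measure_pmf.prob (?P J) ?S"
    by (rule prob_pair_pmf_Times)
  finally show ?case
    using insert row by simp
qed auto

lemma finite_vertices: "finite (vertices k m)"
  unfolding vertices_def compartment_def by auto

text \<open>The bound \<open>L \<le> k\<close> keeps the window from overlapping itself modulo
  \<open>k\<close>, so it consists of \<open>L\<close> distinct, hence independent, rows.\<close>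

lemma prob_window_without_barrier:
  assumes "L \<le> k"
  shows "measure_pmf.prob (Pi_pmf (vertices k m) 0 (\<lambda>_. D))
           {d. \<forall>a\<in>{1..L}. \<not> barrier m d ((i + a) mod k)}
         = (1 - measure_pmf.prob D {..1} ^ m) ^ L"
proof (cases "L = 0")
  case False
  with assms have "k > 0" by auto
  let ?f = "\<lambda>a. (i + a) mod k"
  have inj: "inj_on ?f {1..L}"
  proof (rule linorder_inj_onI)
    fix a b assume ab: "a < b" "a \<in> {1..L}" "b \<in> {1..L}"
    show "?f a \<noteq> ?f b"
    proof
      assume "?f a = ?f b"
      then have "k dvd (i + b) - (i + a)" using ab by (intro mod_eq_dvd_iff_nat[THEN iffD1]) auto
      then have "k \<le> b - a" using ab by (auto dest: dvd_imp_le)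
      then show False using ab assms by auto
    qed
  qed auto
  define J where "J = ?f ` {1..L}"
  have J: "finite J" "card J = L" using card_image[OF inj] by (auto simp: J_def)
  have sub: "J \<times> {..<m} \<subseteq> vertices k m"
    using \<open>k > 0\<close> unfolding J_def vertices_def compartment_def by auto
  have "measure_pmf.prob (Pi_pmf (J \<times> {..<m}) 0 (\<lambda>_. D)) {d. \<forall>j\<in>J. \<exists>v\<in>{..<m}. d (j, v) \<notin> {..1}}
      = measure_pmf.prob (Pi_pmf (vertices k m) 0 (\<lambda>_. D))
           {d. \<forall>a\<in>{1..L}. \<not> barrier m d ((i + a) mod k)}"
    \<comment> \<open>The law on the window is the image of the full law under resetting the outside
      coordinates to 0; the event only reads coordinates inside.\<close>
    unfolding Pi_pmf_subset[OF finite_vertices sub] measure_map_pmf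
    by (intro arg_cong[where f = "measure_pmf.prob _"]) (auto simp: J_def barrier_def)
  then show ?thesis
    using prob_Pi_pmf_all_rows[OF J(1), of "{..<m}" 0 D "{..1}"] J(2) by simp
qed auto

text \<open>Outside the bad set \<open>B\<close> of degree sequences, every possible matching has
  only small components. All the randomness that matters is thus in the degrees, and a union bound
  over the \<open>k\<close> window positions estimates \<open>B\<close>.\<close>

lemma prob_largest_component_gt:
  assumes "L \<le> k" "k > 0" "m > 0"
  shows "measure_pmf.prob (iid_compartment_model k m D)
           {E. largest_component (vertices k m) E > (2 * L + 1) * m}
         \<le> real k * (1 - measure_pmf.prob D {..1} ^ m) ^ L"
proof -
  let ?P = "Pi_pmf (vertices k m) 0 (\<lambda>_. D)"
  let ?S = "{E. largest_component (vertices k m) E > (2 * L + 1) * m}"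
  let ?W = "\<lambda>i. {d. \<forall>a\<in>{1..L}. \<not> barrier m d ((i + a) mod k)}"
  define B where "B = (\<Union>i<k. ?W i)"
  have ne: "vertices k m \<noteq> {}"
    using assms unfolding vertices_def compartment_def by auto
  have zero: "measure_pmf.prob (compartment_model k m d) ?S = 0" if "d \<notin> B" for d
  proof -
    have "largest_component (vertices k m) E \<le> (2 * L + 1) * m"
      if "E \<in> set_pmf (compartment_model k m d)" for E
      using card_component_le[of E k m d _ L] set_random_matching that \<open>d \<notin> B\<close> \<open>k > 0\<close> ne
      unfolding largest_component_def compartment_model_def B_def
      by (subst Max_le_iff) (auto simp: finite_vertices)
    then show ?thesis
      by (subst measure_pmf_zero_iff) force
  qed
  have "emeasure (iid_compartment_model k m D) ?S
      = (\<integral>\<^sup>+d. emeasure (compartment_model k m d) ?S \<partial>measure_pmf ?P)"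
    unfolding iid_compartment_model_def by (rule emeasure_bind_pmf)
  \<comment> \<open>Given \<open>d\<close>, the probability of a large component is 0 outside
    \<open>B\<close> and at most 1 on \<open>B\<close>.\<close>
  also have "\<dots> \<le> (\<integral>\<^sup>+d. indicator B d \<partial>measure_pmf ?P)"
    by (intro nn_integral_mono) (use zero in \<open>simp only: measure_pmf.emeasure_eq_measure indicator_def\<close>, simp)
  also have "\<dots> = emeasure ?P B" by simp
  finally have "measure_pmf.prob (iid_compartment_model k m D) ?S \<le> measure_pmf.prob ?P B"
    by (simp add: measure_pmf.emeasure_eq_measure)
  also have "\<dots> \<le> (\<Sum>i<k. measure_pmf.prob ?P (?W i))"
    unfolding B_def by (intro measure_pmf.finite_measure_subadditive_finite) auto
  also have "\<dots> = real k * (1 - measure_pmf.prob D {..1} ^ m) ^ L"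
    unfolding prob_window_without_barrier[OF assms(1)] by simp
  finally show ?thesis .
qed

section \<open>Asymptotics with windows of length proportional to \<open>n\<close>\<close>

theorem proposition5p1:
  fixes D :: "nat pmf" and p :: real and l :: nat and k :: "nat \<Rightarrow> nat"
  assumes "measure_pmf.prob D {..1} = p" and "p > 0"
    and "l \<ge> 1"
    and "\<And>n. n \<ge> 1 \<Longrightarrow> k n \<ge> 1"
    and "(\<lambda>n. real (k n * l) / real n) \<longlonglongrightarrow> 1"
  shows "\<forall>\<epsilon>>0. (\<lambda>n. measure_pmf.prob (iid_compartment_model (k n) l D)
           {E. \<bar>real (largest_component (vertices (k n) l) E) / real n - 0\<bar> > \<epsilon>}) \<longlonglongrightarrow> 0"
proof (intro allI impI)
  fix \<epsilon> :: real assume "\<epsilon> > 0"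
  let ?F = "\<lambda>n. measure_pmf.prob (iid_compartment_model (k n) l D)
           {E. \<bar>real (largest_component (vertices (k n) l) E) / real n - 0\<bar> > \<epsilon>}"
  define q where "q = p ^ l"
  have "p \<le> 1" using assms(1) by auto
  have q: "q > 0" "q \<le> 1"
    using \<open>p > 0\<close> \<open>p \<le> 1\<close> by (auto simp: q_def power_le_one)
  \<comment> \<open>With \<open>L n\<close> about \<delta> n, the bound
    \<open>4 * l * \<delta> \<le> \<epsilon>\<close> makes \<open>2 * L n * l\<close> at most half
    of \<epsilon> n, the other half absorbing the extra \<open>l\<close> for large \<open>n\<close>.
    The bound by 1 gives \<open>L n \<le> k n\<close> once \<open>k n * l > n / 2\<close>.\<close>
  define \<delta> where "\<delta> = min \<epsilon> 1 / (4 * real l)"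
  have \<delta>: "\<delta> > 0" "4 * real l * \<delta> \<le> \<epsilon>" "4 * real l * \<delta> \<le> 1"
    using \<open>\<epsilon> > 0\<close> \<open>l \<ge> 1\<close> by (auto simp: \<delta>_def)
  define L where "L n = nat \<lfloor>\<delta> * real n\<rfloor>" for n
  have L: "real (L n) \<le> \<delta> * real n" "real (L n) \<ge> \<delta> * real n - 1" for n
    using \<delta>(1) by (auto simp: L_def intro: of_nat_floor)
  have "\<forall>\<^sub>F n in sequentially. real (k n * l) / real n < 2"
    "\<forall>\<^sub>F n in sequentially. real (k n * l) / real n > 1 / 2"
    by (rule order_tendstoD[OF assms(5)]; simp)+
  moreover have "\<forall>\<^sub>F n in sequentially. real n \<ge> 2 * real l / \<epsilon>"
    by real_asymp
  ultimately have "\<forall>\<^sub>F n in sequentially. ?F n \<le> 2 * real n * exp (- q * (\<delta> * real n - 1))"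
    using eventually_ge_at_top[of 1]
  proof eventually_elim
    case (elim n)
    have n: "real n > 0" and l: "real l \<ge> 1" using elim(4) \<open>l \<ge> 1\<close> by auto
    have kl: "real (k n) * real l < 2 * real n" "real (k n) * real l > real n / 2"
      using elim(1,2) n by (auto simp: field_simps)
    have k: "real (k n) \<le> 2 * real n"
      using kl(1) mult_left_mono[OF l, of "real (k n)"] by simp
    have "4 * real l * real (L n) \<le> 4 * real l * (\<delta> * real n)"
      using L(1) by (intro mult_left_mono) auto
    also have "\<dots> = (4 * real l * \<delta>) * real n" by simp
    finally have lL: "4 * real l * real (L n) \<le> (4 * real l * \<delta>) * real n" .
    have "4 * real l * real (L n) \<le> 1 * real n"
      using order_trans[OF lL mult_right_mono[OF \<delta>(3)]] n by simp
    with kl(2) n have "real l * real (L n) \<le> real l * real (k n)"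
      unfolding mult.commute[of "real (k n)"] by linarith
    with l have "L n \<le> k n" by simp
    have "4 * real l * real (L n) \<le> \<epsilon> * real n"
      using order_trans[OF lL mult_right_mono[OF \<delta>(2)]] n by simp
    moreover have "2 * real l \<le> \<epsilon> * real n"
      using elim(3) \<open>\<epsilon> > 0\<close> by (simp add: field_simps)
    ultimately have size: "real ((2 * L n + 1) * l) \<le> \<epsilon> * real n" by (simp add: algebra_simps)
    have "?F n \<le> measure_pmf.prob (iid_compartment_model (k n) l D)
            {E. largest_component (vertices (k n) l) E > (2 * L n + 1) * l}"
    proof (intro measure_pmf.finite_measure_mono subsetI CollectI)
      fix E assume "E \<in> {E. \<bar>real (largest_component (vertices (k n) l) E) / real n - 0\<bar> > \<epsilon>}"
      then have "\<epsilon> * real n < real (largest_component (vertices (k n) l) E)"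
        using n by (simp add: field_simps)
      with size show "largest_component (vertices (k n) l) E > (2 * L n + 1) * l" by linarith
    qed auto
    also have "\<dots> \<le> real (k n) * (1 - q) ^ L n"
      using prob_largest_component_gt[OF \<open>L n \<le> k n\<close>] assms(1,3) assms(4)[OF elim(4)]
      by (auto simp: q_def)
    \<comment> \<open>From \<open>1 - q \<le> exp (- q)\<close> the decay is exponential in
      \<open>L n\<close>; the floor in \<open>L n\<close> costs at most the 1 in the exponent. This
      linear exponent then beats the factor \<open>2 * n\<close> from the union bound.\<close>
    also have "\<dots> \<le> (2 * real n) * exp (- q * (\<delta> * real n - 1))"
    proof (intro mult_mono k)
      have "(1 - q) ^ L n \<le> exp (- q) ^ L n"
        using q exp_ge_add_one_self[of "- q"] by (intro power_mono) auto
      also have "\<dots> = exp (- q * real (L n))" by (simp add: exp_of_nat_mult[symmetric] mult.commute)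
      also have "\<dots> \<le> exp (- q * (\<delta> * real n - 1))"
        using L(2)[of n] q by simp
      finally show "(1 - q) ^ L n \<le> exp (- q * (\<delta> * real n - 1))" .
    qed (use q in auto)
    finally show ?case .
  qed
  moreover have "(\<lambda>n. 2 * real n * exp (- q * (\<delta> * real n - 1))) \<longlonglongrightarrow> 0"
    using q(1) \<delta>(1) by real_asymp
  ultimately show "?F \<longlonglongrightarrow> 0"
    by (intro tendsto_sandwich[of "\<lambda>_. 0" ?F]) auto
qed

end
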